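(* Let $t\neq 0$. For every integer $n\ge 0$, $$\sum_{k=0}^n \frac{(-1)^k}{2 t^k} \left(Q_{k+1} +2(t-1)P_{k}\right) = \frac{(-1)^n}{t^n}P_{n+1},$$ where $P_k$ and $Q_k$ are the $k$th Pell and Pell-Lucas numbers.
   Context: The Pell numbers $P_k$ and Pell-Lucas numbers $Q_k$ ($k\ge 0$) both satisfy $x_{n+2}=2x_{n+1}+x_n$ for $n\ge 0$, with initial values $P_0=0$, $P_1=1$ and $Q_0=Q_1=2$. Here $t$ is an indeterminate, which may be specialized to any nonzero complex number. *)

theory Defs
  imports Complex_Main
begin

fun pell :: "nat \<Rightarrow> nat" where
  "pell 0 = 0"
| "pell (Suc 0) = 1"
| "pell (Suc (Suc n)) = 2 * pell (Suc n) + pell n"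

fun pell_lucas :: "nat \<Rightarrow> nat" where
  "pell_lucas 0 = 2"
| "pell_lucas (Suc 0) = 2"
| "pell_lucas (Suc (Suc n)) = 2 * pell_lucas (Suc n) + pell_lucas n"

end

(* Since Q_(k+1) = 2 (P_(k+1) + P_k), the k-th summand equals
   (-1)^k P_(k+1) / t^k - (-1)^(k-1) P_k / t^(k-1), so the sum telescopes. *)
theory Submission
  imports Defs
begin

text \<open>The telescoping is run as an induction on \<open>n\<close>: by
  \<open>pell_lucas_Suc\<close> the bracket equals 2 (P_(k+1) + t P_k); its second term cancels the
  previous partial sum and its first gives the new one.\<close>

text \<open>Both sides obey the Pell recurrence and agree at 0 and 1, hence the two-step rule
  \<open>pell.induct\<close>.\<close>

lemma pell_lucas_Suc: "pell_lucas (Suc n) = 2 * (pell (Suc n) + pell n)"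
  by (induction n rule: pell.induct) simp_all

(* Class field_char_0 covers both roles of t: a nonzero number (type complex), and an
   indeterminate (the generator of the rational function field, type rat poly fract). *)
theorem mainTheorem5:
  fixes t :: "'a :: field_char_0" and n :: nat
  assumes "t \<noteq> 0"
  shows "(\<Sum>k=0..n. (-1) ^ k / (2 * t ^ k) *
            (of_nat (pell_lucas (k + 1)) + 2 * (t - 1) * of_nat (pell k)))
         = (-1) ^ n / t ^ n * of_nat (pell (n + 1))"
proof (induction n)
  case 0
  show ?case by simp
next
  case (Suc n)
  have "of_nat (pell_lucas (Suc n + 1)) + 2 * (t - 1) * of_nat (pell (Suc n))
      = 2 * (of_nat (pell (Suc n + 1)) + t * of_nat (pell (Suc n)))"
    by (simp add: pell_lucas_Suc algebra_simps del: pell.simps pell_lucas.simps)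
  \<comment> \<open>The cancellation, with \<open>p\<close> and \<open>q\<close> standing for the
    Pell numbers at \<open>n + 1\<close> and \<open>n + 2\<close>; it holds for arbitrary field
    elements.\<close>
  moreover have "(-1) ^ n / t ^ n * p + (-1) ^ Suc n / (2 * t ^ Suc n) * (2 * (q + t * p))
      = (-1) ^ Suc n / t ^ Suc n * q" for p q
    using assms by (simp add: field_simps)
  ultimately show ?case
    \<comment> \<open>The recurrences stay folded so that the terms match \<open>p\<close> and
      \<open>q\<close>.\<close>
    using Suc by (simp del: pell.simps pell_lucas.simps power_Suc)
qed

end
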